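(* Let $A \in \mathbb{R}^{m \times n_A}$ and $B \in \mathbb{R}^{m \times n_B}$ with nonzero columns, let $OPT_k$ be a set of $k$ columns of $B$ maximizing $f_A(S)$ subject to $|S| = k$, with $\sigma_{\min}(OPT_k) > 0$. Let $\varepsilon, \delta > 0$ with $\varepsilon + \delta \le 1$, and let $T_r$ be the set of columns output by $\textsc{Lazier-than-lazy Greedy}(A, B, r)$ for $r = \frac{16k}{\varepsilon\, \sigma_{\min}(OPT_k)}$. Then $$\mathbb{E}[f_A(T_r)] \ge (1 - \varepsilon - \delta)\, f_A(OPT_k).$$ Further, this algorithm evaluates marginal gains only $\frac{16 n_B \log(1/\delta)}{\varepsilon\, \sigma_{\min}(OPT_k)}$ times.
   Context: For a finite set $V$ of vectors in $\mathbb{R}^m$, $\Pi_V$ is the orthogonal projector onto $\mathrm{span}(V)$ and, for a matrix $M$ with $m$ rows, $f_M(V) = \|\Pi_V M\|_F^2$. For a finite set $V$ of nonzero vectors, $\sigma_{\min}(V)$ is the smallest squared singular value of the matrix whose columns are the vectors of $V$ rescaled to unit length. The marginal gain of a column $v$ with respect to a set $T$ is $f_A(T \cup \{v\}) - f_A(T)$. $\textsc{Lazier-than-lazy Greedy}(A, B, r)$: start with $T = \emptyset$; for $r$ iterations, draw a subset $R$ of size $\frac{n_B \log(1/\delta)}{k}$ uniformly at random from the columns of $B$ not in $T$, add to $T$ the column of $R$ with the largest marginal gain with respect to $T$; return $T$.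
   Formalization: The number of iterations and the sample size, in general not integers, are rounded up; a sample is capped at the number of remaining columns (nothing is done if none remain); the bound on marginal-gain evaluations is the product of the two rounded-up numbers. *)

theory Defs
  imports "HOL-Analysis.Analysis" "HOL-Probability.Probability"
begin

text \<open>Columns of a matrix with m rows are vectors in real^'m; a matrix with n columns
  is a function nat => real^'m, used on indices 0..n-1. Sets of columns are index sets.\<close>

definition proj :: "(real^'m) set \<Rightarrow> real^'m \<Rightarrow> real^'m" where
  "proj V a = (THE p. p \<in> span V \<and> (\<forall>v\<in>span V. (a - p) \<bullet> v = 0))"

definition fval :: "nat \<Rightarrow> (nat \<Rightarrow> real^'m) \<Rightarrow> (real^'m) set \<Rightarrow> real" where
  "fval nM M V = (\<Sum>j<nM. (norm (proj V (M j)))^2)"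

definition fcols :: "nat \<Rightarrow> (nat \<Rightarrow> real^'m) \<Rightarrow> (nat \<Rightarrow> real^'m) \<Rightarrow> nat set \<Rightarrow> real" where
  "fcols nA A B S = fval nA A (B ` S)"

definition gain :: "nat \<Rightarrow> (nat \<Rightarrow> real^'m) \<Rightarrow> (nat \<Rightarrow> real^'m) \<Rightarrow> nat set \<Rightarrow> nat \<Rightarrow> real" where
  "gain nA A B T c = fcols nA A B (insert c T) - fcols nA A B T"

text \<open>Smallest squared singular value of the matrix whose columns are B j / norm (B j), j in S:
  the smallest eigenvalue of the Gram matrix M^T M of that matrix.\<close>
definition sigma_min :: "(nat \<Rightarrow> real^'m) \<Rightarrow> nat set \<Rightarrow> real" where
  "sigma_min B S =
     (let u = (\<lambda>j. B j /\<^sub>R norm (B j)) in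
      Min {lam. \<exists>x::nat \<Rightarrow> real. (\<exists>j\<in>S. x j \<noteq> 0) \<and>
              (\<forall>i\<in>S. (\<Sum>j\<in>S. (u i \<bullet> u j) * x j) = lam * x i)})"

text \<open>One iteration of Lazier-than-lazy Greedy. State: (current set T, number of
  marginal-gain evaluations so far). s is the sample size; sel is the rule picking a
  column of R with the largest marginal gain (arbitrary tie-breaking).\<close>
definition ltl_step :: "nat \<Rightarrow> nat \<Rightarrow> (nat set \<Rightarrow> nat set \<Rightarrow> nat) \<Rightarrow> nat set \<times> nat \<Rightarrow> (nat set \<times> nat) pmf" where
  "ltl_step nB s sel st =
     (let T = fst st; c = snd st; avail = {..<nB} - T in
      if avail = {} then return_pmf st
      else bind_pmf (pmf_of_set {R. R \<subseteq> avail \<and> card R = min s (card avail)})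
             (\<lambda>R. return_pmf (insert (sel T R) T, c + card R)))"

definition ltl_greedy :: "nat \<Rightarrow> nat \<Rightarrow> (nat set \<Rightarrow> nat set \<Rightarrow> nat) \<Rightarrow> nat \<Rightarrow> (nat set \<times> nat) pmf" where
  "ltl_greedy nB s sel r = ((\<lambda>p. bind_pmf p (ltl_step nB s sel)) ^^ r) (return_pmf ({}, 0))"

end

theory Submission
  imports Defs
begin

text \<open>Write \<open>F = f (OPT)\<close>. Projecting the residuals of \<open>A\<close> with respect to \<open>T\<close> onto the span of
  \<open>OPT\<close> shows that the marginal gains over \<open>OPT\<close> sum to at least
  \<open>\<sigma>\<^sub>m\<^sub>i\<^sub>n (\<surd>F - \<surd>f(T))\<^sup>2 \<ge> \<sigma>\<^sub>m\<^sub>i\<^sub>n (F - f(T))\<^sup>2 / (4 F)\<close> when \<open>f(T) \<le> F\<close>.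
  A random sample of the prescribed size meets \<open>OPT - T\<close> with probability at least
  \<open>(1 - \<delta>) card (OPT - T) / k\<close>, and its element of that set is then uniform, so one
  step gains in expectation at least \<open>(1 - \<delta>) / k\<close> times that sum. By Jensen's inequality
  the normalised expected deficit \<open>x\<^sub>i\<close> satisfies \<open>x\<^sub>i\<^sub>+\<^sub>1 \<le> x\<^sub>i - a x\<^sub>i\<^sup>2\<close> with
  \<open>a = (1 - \<delta>) \<sigma>\<^sub>m\<^sub>i\<^sub>n / (4 k)\<close> as long as it is positive, hence decays like \<open>1 / (1 + a i)\<close>.\<close>

subsection \<open>Projections and marginal gains\<close>

text \<open>Resolves the definite description in \<open>proj_def\<close>: two candidates differ by a
  vector of the span that is orthogonal to itself.\<close>

lemma proj_eqI:
  assumes "p \<in> span V" "\<And>v. v \<in> span V \<Longrightarrow> (a - p) \<bullet> v = 0"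
  shows "proj V a = p"
  unfolding proj_def
proof (rule the_equality)
  show "p \<in> span V \<and> (\<forall>v\<in>span V. (a - p) \<bullet> v = 0)"
    using assms by blast
next
  fix q assume q: "q \<in> span V \<and> (\<forall>v\<in>span V. (a - q) \<bullet> v = 0)"
  then have d: "q - p \<in> span V"
    using assms(1) by (simp add: span_diff)
  have "(q - p) \<bullet> (q - p) = (a - p) \<bullet> (q - p) - (a - q) \<bullet> (q - p)"
    by (simp add: inner_diff_left)
  then show "q = p"
    using d q assms(2) by simp
qed

lemma
  shows proj_in_span: "proj V a \<in> span V"
    and proj_orthogonal: "v \<in> span V \<Longrightarrow> (a - proj V a) \<bullet> v = 0"
proof -
  obtain y z where yz: "y \<in> span V" "\<And>w. w \<in> span V \<Longrightarrow> orthogonal z w" "a = y + z"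
    using orthogonal_subspace_decomp_exists[of V a] by metis
  then have "proj V a = y"
    by (intro proj_eqI) (auto simp: orthogonal_def)
  then show "proj V a \<in> span V" "v \<in> span V \<Longrightarrow> (a - proj V a) \<bullet> v = 0"
    using yz by (auto simp: orthogonal_def)
qed

lemma proj_inner: "v \<in> span V \<Longrightarrow> v \<bullet> proj V a = v \<bullet> a"
  using proj_orthogonal[of v V a] by (simp add: inner_diff_left inner_diff_right inner_commute)

lemma proj_add: "proj V (a + b) = proj V a + proj V b"
  using proj_orthogonal[of _ V a] proj_orthogonal[of _ V b]
  by (intro proj_eqI) (auto simp: proj_in_span span_add inner_diff_left inner_add_left)

lemma proj_empty: "proj {} a = 0"
  using proj_in_span[of "{}" a] by simp

lemma norm_proj_le: "norm (proj V a) \<le> norm a"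
proof -
  have "norm (proj V a) * norm (proj V a) = proj V a \<bullet> a"
    by (metis dot_square_norm power2_eq_square proj_in_span proj_inner)
  also have "\<dots> \<le> norm (proj V a) * norm a"
    by (rule norm_cauchy_schwarz)
  finally show ?thesis
    by (cases "proj V a = 0") auto
qed

lemma norm_diff_proj_le: "norm (a - proj V a) \<le> norm a"
proof -
  have "(norm a)\<^sup>2 = (norm (a - proj V a))\<^sup>2 + (norm (proj V a))\<^sup>2"
    using proj_orthogonal[OF proj_in_span, of a V a]
    by (simp add: power2_norm_eq_inner inner_diff_left inner_diff_right inner_commute)
  then show ?thesis
    by (simp add: power2_le_imp_le)
qed

text \<open>Pythagoras: \<open>proj V a\<close> lies in both spans, so it has the same inner product
  with \<open>proj W a\<close> as with \<open>proj V a\<close>.\<close>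

lemma proj_mono:
  assumes "V \<subseteq> W"
  shows "(norm (proj W a))\<^sup>2 = (norm (proj V a))\<^sup>2 + (norm (proj W a - proj V a))\<^sup>2"
proof -
  have V: "proj V a \<in> span V" "proj V a \<in> span W"
    using proj_in_span[of V a] span_mono[OF assms] by auto
  show ?thesis
    using proj_inner[OF V(1), of a] proj_inner[OF V(2), of a]
    by (simp add: power2_norm_eq_inner inner_diff_left inner_diff_right inner_commute)
qed

text \<open>Only the part \<open>w\<close> of \<open>v\<close> orthogonal to \<open>span V\<close>
  sees the residual, and it pairs with the residual as with the increment \<open>q\<close> of the
  projection; then Cauchy-Schwarz. The form without division covers \<open>w = 0\<close>.\<close>

lemma proj_gain_lower_bound:
  "(v \<bullet> (a - proj V a))\<^sup>2
     \<le> (norm v)\<^sup>2 * ((norm (proj (insert v V) a))\<^sup>2 - (norm (proj V a))\<^sup>2)"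
proof -
  define w q where "w = v - proj V v" and "q = proj (insert v V) a - proj V a"
  have sub: "span V \<subseteq> span (insert v V)"
    by (rule span_mono) auto
  have w: "w \<in> span (insert v V)"
    unfolding w_def using sub proj_in_span[of V v] by (intro span_diff) (auto intro: span_base)
  have wV: "w \<bullet> proj V a = 0"
    unfolding w_def by (rule proj_orthogonal[OF proj_in_span])
  have "v \<bullet> (a - proj V a) = w \<bullet> (a - proj V a)"
    using proj_orthogonal[OF proj_in_span, of a V v]
    by (simp add: w_def inner_diff_left inner_diff_right inner_commute)
  also have "\<dots> = w \<bullet> q"
    using proj_inner[OF w, of a] wV by (simp add: q_def inner_diff_right)
  finally have "(v \<bullet> (a - proj V a))\<^sup>2 = (w \<bullet> q)\<^sup>2"
    by simp
  also have "\<dots> \<le> (norm w)\<^sup>2 * (norm q)\<^sup>2"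
    using Cauchy_Schwarz_ineq[of w q] by (simp add: power2_norm_eq_inner)
  also have "\<dots> \<le> (norm v)\<^sup>2 * (norm q)\<^sup>2"
    unfolding w_def by (intro mult_right_mono power_mono norm_diff_proj_le) auto
  also have "(norm q)\<^sup>2 = (norm (proj (insert v V) a))\<^sup>2 - (norm (proj V a))\<^sup>2"
    using proj_mono[OF subset_insertI, of v V a] by (simp add: q_def)
  finally show ?thesis .
qed

section \<open>Gram eigenvalues and the frame bound\<close>

text \<open>\<open>sigma_min\<close> is a \<open>Min\<close>, so bounding it by a given eigenvalue
  requires finiteness. Eigenvectors for distinct nonzero eigenvalues, used as coefficients of the
  \<open>u j\<close>, yield nonzero pairwise orthogonal vectors in finite dimension.\<close>

lemma finite_gram_eigenvalues:
  fixes u :: "nat \<Rightarrow> 'a::euclidean_space"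
  shows "finite {lam. \<exists>x::nat \<Rightarrow> real. (\<exists>j\<in>S. x j \<noteq> 0) \<and>
              (\<forall>i\<in>S. (\<Sum>j\<in>S. (u i \<bullet> u j) * x j) = lam * x i)}" (is "finite ?E")
proof (cases "finite S")
  case False
  \<comment> \<open>Sums over an infinite \<open>S\<close> are 0 by convention, which forces
    \<open>lam = 0\<close>.\<close>
  then have "?E \<subseteq> {0}" by auto
  then show ?thesis by (rule finite_subset) simp
next
  case fin: True
  have "\<forall>lam\<in>?E. \<exists>x::nat \<Rightarrow> real. (\<exists>j\<in>S. x j \<noteq> 0) \<and>
              (\<forall>i\<in>S. (\<Sum>j\<in>S. (u i \<bullet> u j) * x j) = lam * x i)"
    by blast
  then obtain X :: "real \<Rightarrow> nat \<Rightarrow> real" where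
    X: "\<And>lam. lam \<in> ?E \<Longrightarrow> \<exists>j\<in>S. X lam j \<noteq> 0"
       "\<And>lam i. lam \<in> ?E \<Longrightarrow> i \<in> S \<Longrightarrow> (\<Sum>j\<in>S. (u i \<bullet> u j) * X lam j) = lam * X lam i"
    unfolding bchoice_iff by blast
  define Y where "Y lam = (\<Sum>j\<in>S. X lam j *\<^sub>R u j)" for lam
  have inner: "Y lam \<bullet> Y mu = mu * (\<Sum>i\<in>S. X lam i * X mu i)" if "mu \<in> ?E" for lam mu
  proof -
    have "Y lam \<bullet> Y mu = (\<Sum>i\<in>S. X lam i * (\<Sum>j\<in>S. (u i \<bullet> u j) * X mu j))"
      unfolding Y_def inner_sum_left
      by (simp add: inner_sum_right sum_distrib_left mult_ac)
    also have "\<dots> = (\<Sum>i\<in>S. X lam i * (mu * X mu i))"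
      by (intro sum.cong refl) (simp add: X(2)[OF that])
    finally show ?thesis
      by (simp add: sum_distrib_left mult_ac)
  qed
  have orth: "Y lam \<bullet> Y mu = 0" if "lam \<in> ?E" "mu \<in> ?E" "lam \<noteq> mu" for lam mu
  proof -
    \<comment> \<open>The inner product is symmetric, so it equals one common sum scaled by
      \<open>mu\<close> and also by \<open>lam\<close>; these differ, so the sum is 0.\<close>
    have "mu * (\<Sum>i\<in>S. X lam i * X mu i) = lam * (\<Sum>i\<in>S. X lam i * X mu i)"
      using inner[OF that(1), of mu] inner[OF that(2), of lam]
      by (simp add: inner_commute mult_ac)
    then show ?thesis
      using that inner[OF that(2), of lam] by auto
  qed
  have nz: "Y lam \<noteq> 0" if lam: "lam \<in> ?E - {0}" for lam
  proof
    assume "Y lam = 0"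
    then have "(\<Sum>i\<in>S. X lam i * X lam i) = 0"
      using inner[of lam lam] lam by auto
    then have "\<forall>i\<in>S. X lam i = 0"
      using fin by (simp add: sum_nonneg_eq_0_iff)
    then show False
      using X(1)[of lam] lam by blast
  qed
  have inj: "inj_on Y (?E - {0})"
    by (rule inj_onI) (metis (no_types, lifting) DiffD1 inner_eq_zero_iff nz orth)
  have "pairwise orthogonal (Y ` (?E - {0}))"
    by (rule pairwise_imageI) (simp add: orthogonal_def orth del: mem_Collect_eq)
  moreover have "0 \<notin> Y ` (?E - {0})"
    by (metis (no_types, lifting) imageE nz)
  ultimately have "finite (Y ` (?E - {0}))"
    by (intro independent_imp_finite pairwise_orthogonal_independent)
  then have "finite (?E - {0})"
    using inj by (rule finite_imageD)
  then show ?thesis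
    by simp
qed

text \<open>First-order condition for the minimiser of the Rayleigh quotient below.\<close>

lemma linear_term_zero:
  fixes b c :: real
  assumes "\<And>t. 0 \<le> 2 * t * b + t\<^sup>2 * c"
  shows "b = 0"
proof (rule ccontr)
  assume "b \<noteq> 0"
  \<comment> \<open>At \<open>t = - b / d\<close> the quadratic equals b^2 (c - 2 d) / d^2, which is
    negative once \<open>d\<close> exceeds both 0 and \<open>c\<close>.\<close>
  define d where "d = \<bar>c\<bar> + 1"
  have d: "d > 0" "c < d" by (auto simp: d_def)
  have "0 \<le> d\<^sup>2 * (2 * (- b / d) * b + (- b / d)\<^sup>2 * c)"
    using assms[of "- b / d"] by simp
  also have "\<dots> = b\<^sup>2 * (c - 2 * d)"
    using d by (simp add: field_simps power2_eq_square)
  also have "\<dots> < 0"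
    using \<open>b \<noteq> 0\<close> d by (intro mult_pos_neg) auto
  finally show False by simp
qed

text \<open>Every eigenvalue of the frame operator \<open>\<Sum>j. u\<^sub>j u\<^sub>j\<^sup>T\<close> on the span is one of the
  Gram matrix; the minimiser of its Rayleigh quotient is an eigenvector.\<close>

lemma sigma_min_le_frame:
  fixes B :: "nat \<Rightarrow> real^'m"
  assumes fin: "finite S" and z: "z \<in> span (B ` S)"
  shows "sigma_min B S * (norm z)\<^sup>2 \<le> (\<Sum>j\<in>S. ((B j /\<^sub>R norm (B j)) \<bullet> z)\<^sup>2)"
proof (cases "z = 0")
  case False
  define u where "u j = B j /\<^sub>R norm (B j)" for j
  define W where "W = span (B ` S)"
  define Q where "Q z = (\<Sum>j\<in>S. (u j \<bullet> z)\<^sup>2)" for z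
  have uW: "u j \<in> W" if "j \<in> S" for j
    unfolding u_def W_def using that by (intro span_scale span_base) auto
  have W: "subspace W"
    by (simp add: W_def)
  \<comment> \<open>Used later to see that the coordinates \<open>u j \<bullet> y\<close> of the
    minimiser do not all vanish.\<close>
  have zero: "y = 0" if y: "y \<in> W" "\<And>j. j \<in> S \<Longrightarrow> u j \<bullet> y = 0" for y
  proof -
    have "orthogonal y b" if "b \<in> B ` S" for b
      using that y(2) by (force simp: orthogonal_def u_def inner_commute)
    then have "orthogonal y y"
      using y(1) orthogonal_to_span unfolding W_def by blast
    then show ?thesis by (simp add: orthogonal_self)
  qed
  have "compact (W \<inter> sphere 0 1)"
    by (simp add: W closed_Int_compact closed_subspace)
  moreover have "z /\<^sub>R norm z \<in> W \<inter> sphere 0 1"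
    using z W False by (simp add: W_def span_scale)
  moreover have "continuous_on (W \<inter> sphere 0 1) Q"
    unfolding Q_def by (intro continuous_intros)
  ultimately obtain y where y: "y \<in> W \<inter> sphere 0 1" "\<And>w. w \<in> W \<inter> sphere 0 1 \<Longrightarrow> Q y \<le> Q w"
    using continuous_attains_inf[of "W \<inter> sphere 0 1" Q] by blast
  define lam where "lam = Q y"
  have ray: "lam * (norm w)\<^sup>2 \<le> Q w" if "w \<in> W" for w
  proof (cases "w = 0")
    case False
    then have "lam \<le> Q (w /\<^sub>R norm w)"
      unfolding lam_def using that W by (intro y(2)) (auto simp: subspace_scale)
    also have "\<dots> = Q w / (norm w)\<^sup>2"
      by (simp add: Q_def power_mult_distrib divide_inverse sum_distrib_left power_inverse mult_ac)
    finally show ?thesis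
      using False by (simp add: pos_le_divide_eq)
  qed (simp add: Q_def)
  define My where "My = (\<Sum>j\<in>S. (u j \<bullet> y) *\<^sub>R u j)"
  \<comment> \<open>Along \<open>y + t *\<^sub>R w\<close> the excess of \<open>Q\<close> over
    \<open>lam\<close> times the squared norm is nonnegative, and it is 0 at \<open>t = 0\<close>
    because \<open>y\<close> is a unit vector.\<close>
  have crit: "(My - lam *\<^sub>R y) \<bullet> w = 0" if w: "w \<in> W" for w
  proof (rule linear_term_zero)
    fix t :: real
    have "y + t *\<^sub>R w \<in> W"
      using y(1) w W by (auto intro: subspace_add subspace_scale)
    from ray[OF this] have "0 \<le> Q (y + t *\<^sub>R w) - lam * (norm (y + t *\<^sub>R w))\<^sup>2"
      by simp
    moreover have "Q (y + t *\<^sub>R w) = lam + 2 * t * (My \<bullet> w) + t\<^sup>2 * Q w"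
      by (simp add: Q_def lam_def My_def inner_sum_left inner_add_right power2_sum
          sum.distrib sum_distrib_left power_mult_distrib mult_ac)
    moreover have "y \<bullet> y = 1"
      using y(1) by (simp add: norm_eq_1)
    then have "(norm (y + t *\<^sub>R w))\<^sup>2 = 1 + 2 * t * (y \<bullet> w) + t\<^sup>2 * (norm w)\<^sup>2"
      unfolding power2_norm_eq_inner
      by (simp add: inner_add_left inner_add_right inner_commute power2_eq_square)
    ultimately show "0 \<le> 2 * t * ((My - lam *\<^sub>R y) \<bullet> w) + t\<^sup>2 * (Q w - lam * (norm w)\<^sup>2)"
      by (simp add: inner_diff_left algebra_simps)
  qed
  \<comment> \<open>The defect of the eigenvalue equation lies in \<open>W\<close>, so it may be
    tested against itself.\<close>
  have "My - lam *\<^sub>R y \<in> W"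
    unfolding My_def using y(1) uW W
    by (auto intro!: subspace_diff subspace_sum subspace_scale)
  from crit[OF this] have My: "My = lam *\<^sub>R y"
    by simp
  have "\<exists>j\<in>S. u j \<bullet> y \<noteq> 0"
    using zero[of y] y(1) by force
  \<comment> \<open>Pairing the equation with \<open>u i\<close> makes the coordinates of
    \<open>y\<close> an eigenvector of the Gram matrix.\<close>
  moreover have "(\<Sum>j\<in>S. (u i \<bullet> u j) * (u j \<bullet> y)) = lam * (u i \<bullet> y)" for i
    using arg_cong[OF My, of "\<lambda>v. u i \<bullet> v"]
    by (simp add: My_def inner_sum_right mult_ac)
  ultimately have "sigma_min B S \<le> lam"
    unfolding sigma_min_def Let_def u_def[symmetric]
    by (intro Min_le finite_gram_eigenvalues) (auto intro!: exI[of _ "\<lambda>j. u j \<bullet> y"])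
  then have "sigma_min B S * (norm z)\<^sup>2 \<le> lam * (norm z)\<^sup>2"
    by (rule mult_right_mono) simp
  also have "\<dots> \<le> Q z"
    using z by (intro ray) (simp add: W_def)
  finally show ?thesis
    by (simp add: Q_def u_def)
qed simp

section \<open>Marginal gains over the comparison set\<close>

lemma fcols_nonneg: "0 \<le> fcols nA A B S"
  by (simp add: fcols_def fval_def sum_nonneg)

lemma fcols_empty: "fcols nA A B {} = 0"
  by (simp add: fcols_def fval_def proj_empty)

lemma fcols_mono: "S \<subseteq> T \<Longrightarrow> fcols nA A B S \<le> fcols nA A B T"
  unfolding fcols_def fval_def
  by (intro sum_mono) (simp add: proj_mono[OF image_mono])

lemma gain_nonneg: "0 \<le> gain nA A B T j"
  by (simp add: gain_def fcols_mono subset_insertI)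

text \<open>\<open>proj_gain_lower_bound\<close> summed over the columns of \<open>A\<close>. For
  \<open>B j = 0\<close> the normalised column is also 0 and \<open>gain_nonneg\<close>
  suffices.\<close>

lemma gain_lower_bound:
  fixes B :: "nat \<Rightarrow> real^'m"
  shows "(\<Sum>i<nA. ((B j /\<^sub>R norm (B j)) \<bullet> (A i - proj (B ` T) (A i)))\<^sup>2) \<le> gain nA A B T j"
proof (cases "B j = 0")
  case False
  have "((B j /\<^sub>R norm (B j)) \<bullet> (a - proj (B ` T) a))\<^sup>2
      \<le> (norm (proj (B ` insert j T) a))\<^sup>2 - (norm (proj (B ` T) a))\<^sup>2" for a
    using proj_gain_lower_bound[of "B j" a "B ` T"] False
    by (simp add: power_mult_distrib power_inverse field_simps)
  then show ?thesis
    unfolding gain_def fcols_def fval_def sum_subtractf[symmetric] by (intro sum_mono)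
qed (simp add: gain_nonneg)

text \<open>\<open>D\<close> is the Frobenius norm of the residuals projected onto the span of
  \<open>S\<close>. Minkowski's inequality bounds the difference of the roots by \<open>D\<close>;
  the frame bound relates \<open>D\<close> to the correlations in
  \<open>gain_lower_bound\<close>.\<close>

lemma sum_gain_ge_sqrt:
  fixes A B :: "nat \<Rightarrow> real^'m"
  assumes fin: "finite S" and sig: "0 \<le> sigma_min B S"
    and le: "fcols nA A B T \<le> fcols nA A B S"
  shows "sigma_min B S * (sqrt (fcols nA A B S) - sqrt (fcols nA A B T))\<^sup>2
    \<le> (\<Sum>j\<in>S. gain nA A B T j)"
proof -
  define PS PT where "PS = proj (B ` S)" and "PT = proj (B ` T)"
  define D where "D = L2_set (\<lambda>i. norm (PS (A i - PT (A i)))) {..<nA}"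
  have "norm (PS a) \<le> norm (PS (a - PT a)) + norm (PT a)" for a
  proof -
    have "PS a = PS (a - PT a) + PS (PT a)"
      unfolding PS_def proj_add[symmetric] by simp
    then show ?thesis
      using norm_triangle_ineq[of "PS (a - PT a)" "PS (PT a)"] norm_proj_le[of "B ` S" "PT a"]
      by (simp add: PS_def)
  qed
  then have "L2_set (\<lambda>i. norm (PS (A i))) {..<nA}
      \<le> L2_set (\<lambda>i. norm (PS (A i - PT (A i))) + norm (PT (A i))) {..<nA}"
    by (intro L2_set_mono) auto
  also have "\<dots> \<le> D + L2_set (\<lambda>i. norm (PT (A i))) {..<nA}"
    unfolding D_def by (rule L2_set_triangle_ineq)
  finally have "sqrt (fcols nA A B S) - sqrt (fcols nA A B T) \<le> D"
    by (simp add: L2_set_def fcols_def fval_def PS_def PT_def)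
  then have "(sqrt (fcols nA A B S) - sqrt (fcols nA A B T))\<^sup>2 \<le> D\<^sup>2"
    using le by (intro power_mono) auto
  then have "sigma_min B S * (sqrt (fcols nA A B S) - sqrt (fcols nA A B T))\<^sup>2
      \<le> sigma_min B S * D\<^sup>2"
    using sig by (rule mult_left_mono)
  also have "\<dots> = (\<Sum>i<nA. sigma_min B S * (norm (PS (A i - PT (A i))))\<^sup>2)"
    by (simp add: D_def L2_set_def sum_nonneg sum_distrib_left)
  also have "\<dots> \<le> (\<Sum>i<nA. \<Sum>j\<in>S. ((B j /\<^sub>R norm (B j)) \<bullet> PS (A i - PT (A i)))\<^sup>2)"
    unfolding PS_def by (intro sum_mono sigma_min_le_frame fin proj_in_span)
  \<comment> \<open>The columns indexed by \<open>S\<close> lie in the span, so projecting the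
    residual leaves these inner products unchanged.\<close>
  also have "\<dots> = (\<Sum>i<nA. \<Sum>j\<in>S. ((B j /\<^sub>R norm (B j)) \<bullet> (A i - PT (A i)))\<^sup>2)"
    by (intro sum.cong refl arg_cong[of _ _ "\<lambda>x. x\<^sup>2"])
      (simp add: PS_def proj_inner span_base span_scale)
  also have "\<dots> = (\<Sum>j\<in>S. \<Sum>i<nA. ((B j /\<^sub>R norm (B j)) \<bullet> (A i - PT (A i)))\<^sup>2)"
    by (rule sum.swap)
  also have "\<dots> \<le> (\<Sum>j\<in>S. gain nA A B T j)"
    unfolding PT_def by (intro sum_mono gain_lower_bound)
  finally show ?thesis .
qed

text \<open>Factoring F - f(T) = (p + q) (p - q) with p + q <= 2 p trades the roots for a convex
  function of f(T), as needed for Jensen's inequality; \<open>max 0\<close> admits every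
  \<open>T\<close>.\<close>

lemma sum_gain_lower_bound:
  fixes A B :: "nat \<Rightarrow> real^'m"
  assumes fin: "finite S" and sig: "0 \<le> sigma_min B S"
  shows "sigma_min B S * (max 0 (fcols nA A B S - fcols nA A B T))\<^sup>2 / (4 * fcols nA A B S)
    \<le> (\<Sum>j\<in>S. gain nA A B T j)"
proof (cases "fcols nA A B T < fcols nA A B S")
  case True
  define p q where "p = sqrt (fcols nA A B S)" and "q = sqrt (fcols nA A B T)"
  have pq: "fcols nA A B S = p\<^sup>2" "fcols nA A B T = q\<^sup>2" "0 \<le> q" "q < p"
    using True by (simp_all add: p_def q_def fcols_nonneg)
  have "(max 0 (fcols nA A B S - fcols nA A B T))\<^sup>2 / (4 * fcols nA A B S)
      = ((p + q) * (p - q))\<^sup>2 / (4 * p\<^sup>2)"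
    using True by (simp add: pq algebra_simps power2_eq_square)
  also have "\<dots> = ((p + q) / (2 * p))\<^sup>2 * (p - q)\<^sup>2"
    by (simp add: power_mult_distrib power_divide)
  also have "\<dots> \<le> 1 * (p - q)\<^sup>2"
    using pq by (intro mult_right_mono power_le_one) auto
  finally have "(max 0 (fcols nA A B S - fcols nA A B T))\<^sup>2 / (4 * fcols nA A B S) \<le> (p - q)\<^sup>2"
    by simp
  from mult_left_mono[OF this sig] show ?thesis
    using sum_gain_ge_sqrt[OF fin sig, of nA A T] True by (simp add: p_def q_def)
qed (simp add: sum_nonneg gain_nonneg)

subsection \<open>Random samples\<close>

text \<open>Division-free form of (M choose s) / (N choose s) <= (M / N)^s: each factor (M - i) / (N
  - i) is at most M / N.\<close>

lemma binomial_mult_power_le: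
  fixes M N s :: nat
  assumes "M \<le> N"
  shows "(M choose s) * N ^ s \<le> (N choose s) * M ^ s"
proof (induction s)
  case (Suc s)
  have absorb: "Suc s * (n choose Suc s) = (n - s) * (n choose s)" for n
    using binomial_absorption[of s n] binomial_absorb_comp[of n s] by simp
  have le: "(M - s) * N \<le> (N - s) * M"
    using assms by (simp add: diff_mult_distrib mult.commute[of M N] diff_le_mono2)
  have "Suc s * ((M choose Suc s) * N ^ Suc s) = ((M choose s) * N ^ s) * ((M - s) * N)"
    unfolding mult.assoc[symmetric] absorb by (simp add: mult_ac)
  also have "\<dots> \<le> ((N choose s) * M ^ s) * ((N - s) * M)"
    by (intro mult_le_mono Suc.IH le)
  also have "\<dots> = Suc s * ((N choose Suc s) * M ^ Suc s)"
    unfolding mult.assoc[symmetric] absorb by (simp add: mult_ac)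
  finally show ?case
    by (metis mult_le_cancel1 zero_less_Suc)
qed simp

text \<open>Of \<open>N\<close> available columns, \<open>d\<close> are wanted. The miss probability
  is at most (1 - d/N)^s <= exp (- s d / N) <= delta^(d/k), and convexity of exp bounds the last
  power linearly.\<close>

lemma binomial_miss_bound:
  fixes d k n N s :: nat and delta :: real
  assumes d: "0 < d" "d \<le> N" "d \<le> k" and N: "N \<le> n"
    and delta: "0 < delta" "delta < 1" and s: "n * ln (1 / delta) \<le> s * k"
  shows "real ((N - d) choose min s N) \<le> (1 - (1 - delta) * d / k) * real (N choose min s N)"
proof (cases "s < N")
  case False
  \<comment> \<open>Here the sample is everything and cannot miss; only nonnegativity of the
    right-hand side remains.\<close>
  have "(1 - delta) * d \<le> 1 * real k"
    using d delta by (intro mult_mono) auto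
  then show ?thesis
    using False d by (simp add: binomial_eq_0)
next
  case True
  define t where "t = real d / k"
  have t: "0 \<le> t" "t \<le> 1"
    using d by (auto simp: t_def)
  have "real N * ln (1 / delta) \<le> n * ln (1 / delta)"
    using N delta by (intro mult_right_mono) auto
  then have "ln (1 / delta) / k \<le> s / N"
    using s d by (simp add: field_simps)
  from mult_left_mono[OF this, of d] have sN: "- (s * (d / N)) \<le> t * ln delta"
    using delta by (simp add: t_def ln_div field_simps)
  have "real ((N - d) choose s) * N ^ s \<le> (N choose s) * real (N - d) ^ s"
    using binomial_mult_power_le[of "N - d" N s]
    by (metis diff_le_self of_nat_le_iff of_nat_mult of_nat_power)
  then have miss: "real ((N - d) choose s) \<le> (N choose s) * (1 - d / N) ^ s"
    using d True by (simp add: of_nat_diff diff_divide_distrib[symmetric] field_simps power_divide)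
  have "(1 - d / N) ^ s \<le> exp (- (d / N)) ^ s"
    using d exp_ge_add_one_self[of "- (real d / N)"] by (intro power_mono) auto
  moreover have "\<dots> = exp (- (s * (d / N)))"
    by (simp add: exp_of_nat_mult[symmetric])
  moreover have "\<dots> \<le> exp (t * ln delta)"
    using sN by simp
  \<comment> \<open>The chord of exp from 0 to \<open>ln delta\<close> lies above its graph.\<close>
  moreover have "exp (t * ln delta) \<le> 1 - t * (1 - delta)"
    using convex_onD[OF exp_convex, of t 0 "ln delta"] t delta by (simp add: algebra_simps)
  ultimately have "(1 - d / N) ^ s \<le> 1 - t * (1 - delta)"
    by linarith
  from mult_left_mono[OF this, of "real (N choose s)"]
  have "real ((N - d) choose s) \<le> (N choose s) * (1 - t * (1 - delta))"
    using miss by linarith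
  then show ?thesis
    using True by (simp add: t_def mult_ac)
qed

text \<open>Giving every \<open>j\<close> in a sample \<open>R\<close> that meets \<open>D\<close> the weight \<open>1 / card (R \<inter> D)\<close>, the total
  weight of \<open>j \<in> D\<close> does not depend on \<open>j\<close>, by symmetry under transpositions.\<close>

lemma sum_samples_lower_bound:
  fixes g :: "'a \<Rightarrow> real" and h :: "'a set \<Rightarrow> real"
  assumes V: "finite V" "D \<subseteq> V" and P: "P = {R. R \<subseteq> V \<and> card R = s}"
    and h: "\<And>R. R \<in> P \<Longrightarrow> 0 \<le> h R" "\<And>R j. R \<in> P \<Longrightarrow> j \<in> R \<inter> D \<Longrightarrow> g j \<le> h R"
  shows "(real (card V choose s) - real ((card V - card D) choose s)) * sum g D \<le> card D * sum h P"
proof (cases "D = {}")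
  case ne: False
  define H where "H = {R \<in> P. R \<inter> D \<noteq> {}}"
  define W where "W j = (\<Sum>R\<in>H. if j \<in> R then 1 / real (card (R \<inter> D)) else 0)" for j
  have finD: "finite D"
    using V finite_subset by blast
  have finP: "finite P"
    unfolding P using V(1) by simp
  then have finH: "finite H"
    by (simp add: H_def)
  have "W i = W j" if ij: "i \<in> D" "j \<in> D" for i j
    unfolding W_def
  proof (rule sum.reindex_bij_witness[where i = "image (Transposition.transpose i j)" and j = "image (Transposition.transpose i j)"])
    fix R assume R: "R \<in> H"
    let ?t = "Transposition.transpose i j"
    show tt: "?t ` ?t ` R = R"
      by (simp add: image_image)
    show "?t ` ?t ` R = R" by (fact tt)
    \<comment> \<open>Swapping two elements of \<open>D\<close> preserves \<open>D\<close> and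
      \<open>V\<close>, hence permutes \<open>H\<close> and keeps the weights.\<close>
    have im: "?t ` D = D" "?t ` V = V"
      using ij V by (simp_all add: transpose_image_eq subset_iff)
    have ID: "?t ` R \<inter> D = ?t ` (R \<inter> D)"
      using im(1) image_Int[of ?t R D] by simp
    have card: "card (?t ` X) = card X" for X
      by (simp add: card_image)
    show "?t ` R \<in> H" and "?t ` R \<in> H"
      using R ID card[of R] image_mono[of R V ?t] im(2) by (auto simp: H_def P)
    have "j \<in> ?t ` R \<longleftrightarrow> i \<in> R"
      by (metis inj_image_mem_iff inj_on_transpose transpose_apply_first)
    then show "(if j \<in> ?t ` R then 1 / real (card (?t ` R \<inter> D)) else 0)
        = (if i \<in> R then 1 / real (card (R \<inter> D)) else 0)"
      by (simp add: ID card)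
  qed
  then obtain w where w: "\<And>j. j \<in> D \<Longrightarrow> W j = w"
    using ne by blast
  have inner: "(\<Sum>j\<in>D. f j * (if j \<in> R then 1 / real (card (R \<inter> D)) else 0))
      = sum f (R \<inter> D) / card (R \<inter> D)" for f :: "'a \<Rightarrow> real" and R
    using finD by (simp add: if_distrib[of "(*) _"] sum.inter_restrict[symmetric] Int_commute
        sum_divide_distrib cong: if_cong)
  have swap: "(\<Sum>j\<in>D. f j * W j) = (\<Sum>R\<in>H. sum f (R \<inter> D) / card (R \<inter> D))" for f
    unfolding W_def sum_distrib_left by (subst sum.swap) (simp only: inner)
  \<comment> \<open>Each sample in \<open>H\<close> distributes total weight 1 over
    \<open>D\<close>, so the weights count \<open>H\<close>.\<close>
  have "card D * w = (\<Sum>j\<in>D. 1 * W j)"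
    by (simp add: w)
  also have "\<dots> = (\<Sum>R\<in>H. 1)"
    unfolding swap using finD by (intro sum.cong) (auto simp: H_def)
  finally have cw: "card D * w = card H"
    by simp
  have "P - H = {R. R \<subseteq> V - D \<and> card R = s}"
    by (auto simp: H_def P)
  then have "card (P - H) = (card V - card D) choose s"
    using V finD by (simp add: n_subsets card_Diff_subset)
  moreover have "card P = card H + card (P - H)"
    using finP finH card_mono[of P H] by (simp add: card_Diff_subset H_def subset_iff)
  ultimately have "real (card V choose s) - real ((card V - card D) choose s) = card H"
    using V(1) by (simp add: P n_subsets)
  then have "(real (card V choose s) - real ((card V - card D) choose s)) * sum g D
      = card D * (\<Sum>j\<in>D. g j * W j)"
    by (simp add: cw[symmetric] w sum_distrib_right[symmetric])
  also have "(\<Sum>j\<in>D. g j * W j) = (\<Sum>R\<in>H. sum g (R \<inter> D) / card (R \<inter> D))"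
    by (rule swap)
  also have "\<dots> \<le> (\<Sum>R\<in>H. h R)"
  proof (rule sum_mono)
    fix R assume R: "R \<in> H"
    then have "card (R \<inter> D) > 0"
      using finD by (simp add: H_def card_gt_0_iff)
    moreover have "sum g (R \<inter> D) \<le> card (R \<inter> D) * h R"
      using R by (intro sum_bounded_above h(2)) (auto simp: H_def)
    ultimately show "sum g (R \<inter> D) / card (R \<inter> D) \<le> h R"
      by (simp add: pos_divide_le_eq mult.commute)
  qed
  also have "\<dots> \<le> sum h P"
    using finP h(1) by (intro sum_mono2) (auto simp: H_def)
  finally show ?thesis
    by (simp add: mult_left_mono)
qed simp

text \<open>The hit probability is proportional to \<open>card D\<close>, while a hit yields at
  least the average of \<open>g\<close> over \<open>D\<close>. The factor \<open>card D\<close>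
  cancels, so the rate per element does not depend on how much of \<open>D\<close> is left.\<close>

lemma sample_mean_lower_bound:
  fixes g :: "'a \<Rightarrow> real" and h :: "'a set \<Rightarrow> real" and k n s :: nat
  assumes V: "finite V" "D \<subseteq> V" "card V \<le> n" and D: "card D \<le> k" and k: "0 < k"
    and P: "P = {R. R \<subseteq> V \<and> card R = min s (card V)}"
    and delta: "0 < delta" "delta < 1" and s: "n * ln (1 / delta) \<le> s * k"
    and g: "\<And>j. j \<in> D \<Longrightarrow> 0 \<le> g j"
    and h: "\<And>R. R \<in> P \<Longrightarrow> 0 \<le> h R" "\<And>R j. R \<in> P \<Longrightarrow> j \<in> R \<inter> D \<Longrightarrow> g j \<le> h R"
  shows "(1 - delta) / k * sum g D \<le> sum h P / card P"
proof (cases "D = {}")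
  case True
  then show ?thesis
    using h(1) by (simp add: sum_nonneg)
next
  case ne: False
  define s' d where "s' = min s (card V)" and "d = card D"
  have d: "0 < d" "d \<le> card V"
    using V ne by (auto simp: d_def card_gt_0_iff card_mono finite_subset)
  have cP: "card P = card V choose s'"
    using V(1) by (simp add: P s'_def n_subsets)
  then have cP0: "card P > 0"
    by (simp add: s'_def)
  have "real ((card V - d) choose s') \<le> (1 - (1 - delta) * d / k) * card P"
    unfolding cP s'_def using d D V(3) delta s by (intro binomial_miss_bound) (auto simp: d_def)
  then have "(1 - delta) * d / k * card P \<le> real (card V choose s') - real ((card V - d) choose s')"
    by (simp add: cP algebra_simps)
  then have "(1 - delta) * d / k * card P * sum g D
      \<le> (real (card V choose s') - real ((card V - d) choose s')) * sum g D"
    by (intro mult_right_mono) (auto intro: sum_nonneg g)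
  also have "\<dots> \<le> d * sum h P"
    unfolding d_def s'_def by (rule sum_samples_lower_bound[OF V(1,2) P h])
  finally have "d * ((1 - delta) / k * sum g D * card P) \<le> d * sum h P"
    by (simp add: mult_ac)
  then have "(1 - delta) / k * sum g D * card P \<le> sum h P"
    by (rule mult_left_le_imp_le) (use d(1) in simp)
  then show ?thesis
    using cP0 by (simp add: pos_le_divide_eq)
qed

section \<open>A quadratic recurrence\<close>

text \<open>Discrete analogue of x' = - a x^2 with solution 1 / (1 + a t).\<close>

lemma quadratic_decay:
  fixes x :: "nat \<Rightarrow> real"
  assumes "0 \<le> a" "x 0 \<le> 1" and step: "\<And>i. x (Suc i) \<le> x i - a * (max 0 (x i))\<^sup>2"
  shows "x i * (1 + a * i) \<le> 1"
proof (induction i)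
  case (Suc i)
  show ?case
  proof (cases "x (Suc i) \<le> 0")
    case True
    then have "x (Suc i) * (1 + a * Suc i) \<le> 0"
      using assms(1) by (intro mult_nonpos_nonneg) auto
    then show ?thesis by simp
  next
    case False
    have "0 \<le> a * (max 0 (x i))\<^sup>2"
      using assms(1) by simp
    then have pos: "0 < x i"
      using step[of i] False by linarith
    then have le: "x (Suc i) \<le> x i * (1 - a * x i)"
      using step[of i] by (simp add: algebra_simps power2_eq_square)
    then have f: "0 < 1 - a * x i"
      using False pos by (smt (verit) zero_less_mult_pos)
    have "x (Suc i) * (1 + a * Suc i) \<le> x i * (1 - a * x i) * (1 + a * Suc i)"
      using assms(1) by (intro mult_right_mono le) auto
    \<comment> \<open>Regrouped so that the induction hypothesis bounds the second factor by
      \<open>1 + a * x i\<close>.\<close>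
    also have "\<dots> = (1 - a * x i) * (x i * (1 + a * i) + a * x i)"
      by (simp add: algebra_simps)
    also have "\<dots> \<le> (1 - a * x i) * (1 + a * x i)"
      using f Suc.IH by (intro mult_left_mono) auto
    also have "\<dots> = 1 - (a * x i)\<^sup>2"
      by (simp add: algebra_simps power2_eq_square)
    finally show ?thesis
      by (smt (verit) zero_le_power2)
  qed
qed (use assms in simp)

subsection \<open>The greedy process\<close>

text \<open>\<open>pmf_of_set\<close> needs a finite nonempty set; capping the sample size at
  \<open>card V\<close> ensures the latter.\<close>

lemma finite_samples:
  assumes "finite V"
  shows "finite {R. R \<subseteq> V \<and> card R = min s (card V)}"
    and "{R. R \<subseteq> V \<and> card R = min s (card V)} \<noteq> {}"
  using assms by (auto intro: obtain_subset_with_card_n[OF min.cobounded2])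

lemma ltl_step_eq:
  assumes "{..<nB} - fst st \<noteq> {}"
  shows "ltl_step nB s sel st =
    pmf_of_set {R. R \<subseteq> {..<nB} - fst st \<and> card R = min s (card ({..<nB} - fst st))} \<bind>
      (\<lambda>R. return_pmf (insert (sel (fst st) R) (fst st), snd st + card R))"
  unfolding ltl_step_def Let_def if_not_P[OF assms] ..

lemma finite_set_pmf_ltl_step: "finite (set_pmf (ltl_step nB s sel st))"
  using finite_samples[of "{..<nB} - fst st" s]
  by (cases "{..<nB} - fst st = {}") (simp add: ltl_step_def, simp add: ltl_step_eq)

lemma finite_set_pmf_ltl_greedy: "finite (set_pmf (ltl_greedy nB s sel i))"
  unfolding ltl_greedy_def by (induction i) (auto simp: finite_set_pmf_ltl_step)

lemma ltl_greedy_Suc: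
  "ltl_greedy nB s sel (Suc i) = ltl_greedy nB s sel i \<bind> ltl_step nB s sel"
  by (simp add: ltl_greedy_def)

text \<open>The selection rule is constrained only on finite nonempty sets.\<close>

lemma sample_nonempty:
  assumes "finite V" "V \<noteq> {}" "0 < s" "R \<subseteq> V" "card R = min s (card V)"
  shows "finite R" "R \<noteq> {}"
proof -
  have "0 < card R"
    using assms by (simp add: card_gt_0_iff)
  then show "finite R" "R \<noteq> {}"
    by (simp_all add: card_gt_0_iff)
qed

lemma set_pmf_ltl_step:
  assumes st': "st' \<in> set_pmf (ltl_step nB s sel st)" and T: "fst st \<subseteq> {..<nB}" and s: "0 < s"
    and sel: "\<And>T R. finite R \<Longrightarrow> R \<noteq> {} \<Longrightarrow> sel T R \<in> R"
  shows "fst st' \<subseteq> {..<nB} \<and> snd st' \<le> snd st + s"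
proof (cases "{..<nB} - fst st = {}")
  case True
  then show ?thesis
    using st' T by (simp add: ltl_step_def)
next
  case False
  define V where "V = {..<nB} - fst st"
  have V: "finite V" "V \<noteq> {}"
    using False by (auto simp: V_def)
  obtain R where R: "R \<subseteq> V" "card R = min s (card V)"
    and st'_eq: "st' = (insert (sel (fst st) R) (fst st), snd st + card R)"
    using st' finite_samples[OF V(1), of s]
    unfolding ltl_step_eq[OF False] V_def[symmetric] by (auto simp: set_pmf_of_set)
  have "sel (fst st) R \<in> R"
    using sel sample_nonempty[OF V s R] by blast
  then show ?thesis
    using st'_eq R T by (auto simp: V_def)
qed

lemma set_pmf_ltl_greedy:
  assumes "0 < s" and "\<And>T R. finite R \<Longrightarrow> R \<noteq> {} \<Longrightarrow> sel T R \<in> R"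
    and "st \<in> set_pmf (ltl_greedy nB s sel i)"
  shows "fst st \<subseteq> {..<nB} \<and> snd st \<le> i * s"
  using assms(3)
proof (induction i arbitrary: st)
  case (Suc i)
  then obtain st0 where st0: "st0 \<in> set_pmf (ltl_greedy nB s sel i)"
      "st \<in> set_pmf (ltl_step nB s sel st0)"
    by (auto simp: ltl_greedy_Suc)
  show ?case
    using set_pmf_ltl_step[OF st0(2) _ assms(1,2)] Suc.IH[OF st0(1)] by fastforce
qed (simp add: ltl_greedy_def)

text \<open>The chosen column gains at least as much as any element of \<open>S - T\<close> in the
  sample, so \<open>sample_mean_lower_bound\<close> applies with \<open>D = S - T\<close>; elements
  of \<open>S\<close> already in \<open>T\<close> have gain 0.\<close>

lemma ltl_step_expectation_ge:
  fixes A B :: "nat \<Rightarrow> real^'m" and k s :: nat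
  assumes S: "S \<subseteq> {..<nB}" "card S = k" and k: "0 < k"
    and delta: "0 < delta" "delta < 1"
    and s0: "0 < s" and s: "nB * ln (1 / delta) \<le> s * k"
    and sel: "\<And>T R. finite R \<Longrightarrow> R \<noteq> {} \<Longrightarrow>
                 sel T R \<in> R \<and> (\<forall>c\<in>R. gain nA A B T c \<le> gain nA A B T (sel T R))"
  shows "fcols nA A B (fst st) + (1 - delta) / k * (\<Sum>j\<in>S. gain nA A B (fst st) j)
    \<le> measure_pmf.expectation (ltl_step nB s sel st) (\<lambda>st. fcols nA A B (fst st))"
proof -
  define T V where "T = fst st" and "V = {..<nB} - T"
  define P where "P = {R. R \<subseteq> V \<and> card R = min s (card V)}"
  have finS: "finite S"
    using S(1) finite_subset by blast
  have zero: "gain nA A B T j = 0" if "j \<in> T" for j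
    using that by (simp add: gain_def insert_absorb)
  have sumD: "(\<Sum>j\<in>S. gain nA A B T j) = (\<Sum>j\<in>S - T. gain nA A B T j)"
    using finS zero by (intro sum.mono_neutral_right) auto
  show ?thesis
  proof (cases "V = {}")
    case True
    then have "S - T = {}"
      using S(1) by (auto simp: V_def)
    with sumD have "(\<Sum>j\<in>S. gain nA A B T j) = 0"
      by (simp only: sum.empty)
    then show ?thesis
      using True by (simp add: ltl_step_def V_def T_def)
  next
    case False
    have finV: "finite V"
      by (simp add: V_def)
    have finP: "finite P" and P: "P \<noteq> {}"
      unfolding P_def using finite_samples[OF finV] by auto
    define h where "h R = gain nA A B T (sel T R)" for R
    have "(1 - delta) / k * (\<Sum>j\<in>S - T. gain nA A B T j) \<le> sum h P / card P"
    proof (rule sample_mean_lower_bound[OF finV _ _ _ k P_def delta s])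
      show "S - T \<subseteq> V"
        using S(1) by (auto simp: V_def)
      show "card V \<le> nB"
        by (metis V_def card_lessThan card_mono finite_lessThan Diff_subset)
      show "card (S - T) \<le> k"
        using S(2) finS card_mono by fastforce
      show "gain nA A B T j \<le> h R" if "R \<in> P" "j \<in> R \<inter> (S - T)" for R j
        unfolding h_def
        using sel[of R T] sample_nonempty[OF finV False s0, of R] that by (auto simp: P_def)
    qed (simp_all add: gain_nonneg h_def)
    moreover have "measure_pmf.expectation (ltl_step nB s sel st) (\<lambda>st. fcols nA A B (fst st))
        = (\<Sum>R\<in>P. fcols nA A B (insert (sel T R) T) / card P)"
      unfolding ltl_step_eq[OF False[unfolded V_def T_def]] T_def[symmetric] V_def[symmetric]
        P_def[symmetric]
      using P finP by (simp add: pmf_expectation_bind_pmf_of_set divide_inverse mult.commute)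
    moreover have "(\<Sum>R\<in>P. fcols nA A B (insert (sel T R) T) / card P)
        = fcols nA A B T + sum h P / card P"
      using P finP
      by (simp add: h_def gain_def sum_subtractf diff_divide_distrib sum_divide_distrib[symmetric])
    ultimately show ?thesis
      by (simp add: sumD T_def[symmetric])
  qed
qed

lemma ltl_greedy_expectation_Suc:
  fixes A B :: "nat \<Rightarrow> real^'m" and k s nA nB :: nat and sel :: "nat set \<Rightarrow> nat set \<Rightarrow> nat"
  defines "E \<equiv> \<lambda>i. measure_pmf.expectation (ltl_greedy nB s sel i) (\<lambda>st. fcols nA A B (fst st))"
  assumes S: "S \<subseteq> {..<nB}" "card S = k" and k: "0 < k" and sigma: "0 \<le> sigma_min B S"
    and delta: "0 < delta" "delta < 1"
    and s0: "0 < s" and s: "nB * ln (1 / delta) \<le> s * k"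
    and sel: "\<And>T R. finite R \<Longrightarrow> R \<noteq> {} \<Longrightarrow>
                 sel T R \<in> R \<and> (\<forall>c\<in>R. gain nA A B T c \<le> gain nA A B T (sel T R))"
  shows "E i + (1 - delta) * sigma_min B S / (4 * k * fcols nA A B S)
      * (max 0 (fcols nA A B S - E i))\<^sup>2 \<le> E (Suc i)"
proof -
  define F f p where "F = fcols nA A B S" and "f st = fcols nA A B (fst st)"
    and "p = ltl_greedy nB s sel i" for st :: "nat set \<times> nat"
  define m c where "m = max 0 (F - E i)" and "c = (1 - delta) * sigma_min B S / (4 * k * F)"
  have c: "0 \<le> c"
    unfolding c_def F_def using delta sigma by (auto intro!: divide_nonneg_nonneg simp: fcols_nonneg)
  have m: "0 \<le> m"
    by (simp add: m_def)
  have fin: "finite (set_pmf p)"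
    by (simp add: p_def finite_set_pmf_ltl_greedy)
  have int: "integrable (measure_pmf p) g" for g :: "nat set \<times> nat \<Rightarrow> real"
    by (rule integrable_measure_pmf_finite[OF fin])
  have finS: "finite S"
    using S(1) finite_subset by blast
  \<comment> \<open>Jensen's inequality, in the form of the tangent bound \<open>m (2x - m) \<le> (max 0 x)\<^sup>2\<close>\<close>
  have step: "f st + c * (m * (2 * (F - f st) - m))
      \<le> measure_pmf.expectation (ltl_step nB s sel st) f" for st
  proof -
    define x where "x = F - f st"
    have "m * (2 * x - m) \<le> m * (2 * max 0 x - m)"
      using m by (intro mult_left_mono) auto
    also have "\<dots> \<le> (max 0 x)\<^sup>2"
      using zero_le_power2[of "max 0 x - m"] by (simp add: power2_eq_square algebra_simps)
    finally have "c * (m * (2 * x - m)) \<le> c * (max 0 x)\<^sup>2"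
      using c by (rule mult_left_mono)
    also have "\<dots> = (1 - delta) / k * (sigma_min B S * (max 0 x)\<^sup>2 / (4 * F))"
      by (simp add: c_def)
    also have "\<dots> \<le> (1 - delta) / k * (\<Sum>j\<in>S. gain nA A B (fst st) j)"
      unfolding x_def F_def f_def using delta sum_gain_lower_bound[OF finS sigma]
      by (intro mult_left_mono) auto
    finally show ?thesis
      using ltl_step_expectation_ge[OF S k delta s0 s sel, of st]
      by (simp add: x_def f_def[abs_def])
  qed
  \<comment> \<open>The tangent bound is affine in \<open>f st\<close>, so it commutes with the
    expectation, and it is exact at the mean deficit.\<close>
  have "m * (2 * (F - E i) - m) = m\<^sup>2"
    by (simp add: m_def max_def power2_eq_square)
  then have "E i + c * m\<^sup>2 = E i + c * (m * (2 * (F - E i) - m))"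
    by simp
  also have "\<dots> = measure_pmf.expectation p (\<lambda>st. f st + c * (m * (2 * (F - f st) - m)))"
    using int by (simp add: E_def f_def p_def)
  also have "\<dots> \<le> measure_pmf.expectation p
      (\<lambda>st. measure_pmf.expectation (ltl_step nB s sel st) f)"
    by (intro integral_mono int step)
  also have "\<dots> = E (Suc i)"
    unfolding E_def ltl_greedy_Suc f_def[abs_def] p_def[symmetric]
    by (subst pmf_expectation_bind[OF fin finite_set_pmf_ltl_step order.refl],
        subst integral_measure_pmf[OF fin]) auto
  finally show ?thesis
    by (simp add: F_def c_def m_def)
qed

theorem theorem5:
  fixes A B :: "nat \<Rightarrow> real^'m" and nA nB k :: nat and OPT :: "nat set"
    and eps delta :: real and sel :: "nat set \<Rightarrow> nat set \<Rightarrow> nat"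
  assumes A_nz: "\<forall>j<nA. A j \<noteq> 0" and B_nz: "\<forall>j<nB. B j \<noteq> 0"
    and k_pos: "k > 0"
    and OPT_sub: "OPT \<subseteq> {..<nB}" and OPT_card: "card OPT = k"
    and OPT_max: "\<forall>S. S \<subseteq> {..<nB} \<and> card S = k \<longrightarrow> fcols nA A B S \<le> fcols nA A B OPT"
    and sigma_pos: "sigma_min B OPT > 0"
    and eps: "eps > 0" and delta: "delta > 0" and ed: "eps + delta \<le> 1"
    and sel: "\<forall>T R. finite R \<and> R \<noteq> {} \<longrightarrow>
                 sel T R \<in> R \<and> (\<forall>c\<in>R. gain nA A B T c \<le> gain nA A B T (sel T R))"
  shows "measure_pmf.expectation
           (ltl_greedy nB (nat \<lceil>real nB * ln (1 / delta) / real k\<rceil>) sel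
              (nat \<lceil>16 * real k / (eps * sigma_min B OPT)\<rceil>))
           (\<lambda>st. fcols nA A B (fst st))
         \<ge> (1 - eps - delta) * fcols nA A B OPT
       \<and> (AE st in measure_pmf (ltl_greedy nB (nat \<lceil>real nB * ln (1 / delta) / real k\<rceil>) sel
              (nat \<lceil>16 * real k / (eps * sigma_min B OPT)\<rceil>)).
            snd st \<le> nat \<lceil>16 * real k / (eps * sigma_min B OPT)\<rceil>
                      * nat \<lceil>real nB * ln (1 / delta) / real k\<rceil>)"
proof
  define s where "s = nat \<lceil>real nB * ln (1 / delta) / real k\<rceil>"
  define r where "r = nat \<lceil>16 * real k / (eps * sigma_min B OPT)\<rceil>"
  define F where "F = fcols nA A B OPT"
  define E where "E i = measure_pmf.expectation (ltl_greedy nB s sel i) (\<lambda>st. fcols nA A B (fst st))" for i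
  have delta1: "delta < 1"
    using eps ed by linarith
  have "0 < nB"
    using OPT_sub OPT_card k_pos by (cases nB) auto
  then have "0 < real nB * ln (1 / delta) / real k"
    using delta delta1 k_pos by simp
  \<comment> \<open>Rounding up keeps the sample nonempty.\<close>
  then have s0: "0 < s"
    by (simp add: s_def)
  have "real nB * ln (1 / delta) / real k \<le> s"
    by (simp add: s_def real_nat_ceiling_ge)
  then have s: "nB * ln (1 / delta) \<le> s * k"
    using k_pos by (simp add: pos_divide_le_eq)
  have sel': "\<And>T R. finite R \<Longrightarrow> R \<noteq> {} \<Longrightarrow>
                 sel T R \<in> R \<and> (\<forall>c\<in>R. gain nA A B T c \<le> gain nA A B T (sel T R))"
    using sel by blast
  show "AE st in measure_pmf (ltl_greedy nB (nat \<lceil>real nB * ln (1 / delta) / real k\<rceil>) sel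
              (nat \<lceil>16 * real k / (eps * sigma_min B OPT)\<rceil>)).
            snd st \<le> nat \<lceil>16 * real k / (eps * sigma_min B OPT)\<rceil>
                      * nat \<lceil>real nB * ln (1 / delta) / real k\<rceil>"
    unfolding s_def[symmetric] r_def[symmetric] AE_measure_pmf_iff
    using set_pmf_ltl_greedy[OF s0] sel' by blast
  have "(1 - eps - delta) * F \<le> E r"
  proof (cases "F = 0")
    case True
    then show ?thesis
      by (simp add: E_def fcols_nonneg)
  next
    case False
    then have F: "0 < F"
      using fcols_nonneg[of nA A B OPT] by (simp add: F_def)
    define a where "a = (1 - delta) * sigma_min B OPT / (4 * k)"
    define x where "x i = (F - E i) / F" for i
    have a: "0 \<le> a"
      using delta1 sigma_pos by (simp add: a_def)
    have x0: "x 0 \<le> 1"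
      using F by (simp add: x_def E_def ltl_greedy_def fcols_empty)
    have step: "x (Suc i) \<le> x i - a * (max 0 (x i))\<^sup>2" for i
    proof -
      define m where "m = max 0 (F - E i)"
      have m: "max 0 (x i) = m / F"
        using F by (auto simp: m_def x_def max_def zero_le_divide_iff)
      have "x i - a * (max 0 (x i))\<^sup>2
          = (F - (E i + (1 - delta) * sigma_min B OPT / (4 * k * F) * m\<^sup>2)) / F"
        unfolding m using F k_pos by (simp add: x_def a_def field_simps power2_eq_square)
      moreover have "E i + (1 - delta) * sigma_min B OPT / (4 * k * F) * m\<^sup>2 \<le> E (Suc i)"
        unfolding m_def E_def F_def
        by (rule ltl_greedy_expectation_Suc[OF OPT_sub OPT_card k_pos _ delta delta1 s0 s sel'])
          (use sigma_pos in simp_all)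
      ultimately show ?thesis
        using F by (simp add: x_def divide_right_mono)
    qed
    \<comment> \<open>This is the claim normalised by \<open>F\<close>.\<close>
    have "x r \<le> eps + delta"
    proof (cases "x r \<le> 0")
      case False
      have "16 * real k / (eps * sigma_min B OPT) \<le> r"
        by (simp add: r_def real_nat_ceiling_ge)
      then have "a * (16 * real k / (eps * sigma_min B OPT)) \<le> a * r"
        using a by (rule mult_left_mono)
      moreover have "a * (16 * real k / (eps * sigma_min B OPT)) = 4 * (1 - delta) / eps"
        using sigma_pos k_pos eps by (simp add: a_def field_simps)
      ultimately have ar: "4 * (1 - delta) / eps \<le> a * r"
        by simp
      have "x r * (4 * (1 - delta) / eps) \<le> x r * (1 + a * r)"
        using ar False by (intro mult_left_mono) auto
      also have "\<dots> \<le> 1"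
        by (rule quadratic_decay[OF a x0 step])
      finally have "x r * (4 * (1 - delta)) \<le> eps"
        using eps by (simp add: field_simps)
      \<comment> \<open>The 4 is the 16 of the iteration count over the 4 in \<open>a\<close>. For
        small \<open>delta\<close> the last factor is at least 1; otherwise
        \<open>eps + delta\<close> exceeds 1/4 and \<open>1 - delta\<close> is at least
        \<open>eps\<close>.\<close>
      also have "eps \<le> (eps + delta) * (4 * (1 - delta))"
      proof (cases "delta \<le> 1 / 2")
        case True
        have "eps \<le> (eps + delta) * 1"
          using delta by simp
        also have "\<dots> \<le> (eps + delta) * (4 * (1 - delta))"
          using True eps delta by (intro mult_left_mono) auto
        finally show ?thesis .
      next
        case False
        then have "(1 / 4) * (4 * eps) \<le> (eps + delta) * (4 * (1 - delta))"
          using eps delta ed by (intro mult_mono) auto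
        then show ?thesis by simp
      qed
      finally show ?thesis
        using delta1 by simp
    qed (use eps delta in simp)
    then show ?thesis
      using F by (simp add: x_def field_simps)
  qed
  then show "(1 - eps - delta) * fcols nA A B OPT \<le> measure_pmf.expectation
           (ltl_greedy nB (nat \<lceil>real nB * ln (1 / delta) / real k\<rceil>) sel
              (nat \<lceil>16 * real k / (eps * sigma_min B OPT)\<rceil>))
           (\<lambda>st. fcols nA A B (fst st))"
    by (simp add: E_def F_def s_def r_def)
qed

end
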